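(* Let $P$ be the distribution of a bivariate vector $(X,Y)$ that has a bivariate semiparametric GLM representation in the model class $\mathcal M$ (defined in the context) with edge $X\to Y$ and canonical-parameter function $\eta$. Then the direction $X\to Y$ is identifiable within the class $\mathcal M$ (that is, every representation of $P$ in $\mathcal M$ has the graph $X\to Y$) if and only if $\eta$ is nonlinear on $\mathring{\mathcal X}_X$ (that is, $\eta$ does not coincide on $\mathring{\mathcal X}_X$ with an affine function).
   Context: Each of the two variables $Z\in\{X,Y\}$ is either continuous (support $\mathcal X_Z\subseteq\mathbb R$ a connected interval with nonempty interior, dominating measure $\nu_Z$ Lebesgue, $\mathring{\mathcal X}_Z=\operatorname{int}\mathcal X_Z$) or count (support $\mathcal X_Z$ a set of consecutive integers, bounded below, with at least three elements, finite or infinite; $\nu_Z$ counting measure; $\mathring{\mathcal X}_Z=\mathcal X_Z$). The types may differ. "Density" includes probability mass functions; the joint density $p$ of $P$ with respect to $\nu_X\otimes\nu_Y$ is finite and strictly positive on $\mathring{\mathcal X}_X\times\mathring{\mathcal X}_Y$. Representations. For $\{U,W\}=\{X,Y\}$, a semiparametric GLM representation of $P$ with edge $U\to W$ is a factorization $$p(u,w)=p_U(u)\,b_W(w)\exp\{w\,\eta(u)-A_W(\eta(u))\},\qquad A_W(t)=\log\int_{\mathcal X_W}b_W(w)e^{wt}\,d\nu_W(w),$$ where the source marginal density $p_U$ is otherwise arbitrary, the base function $b_W$ does not depend on $u$, and the canonical-parameter function $\eta:\mathring{\mathcal X}_U\to\mathbb R$ is nonconstant. A representation with the empty graph is $p(x,y)=p_X(x)p_Y(y)$.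 Regularity of representations: source densities and base functions are finite and strictly positive on their support interiors and their logarithms are $C^2$ in continuous coordinates; $\eta$ is finite, and $C^2$ if $U$ is continuous; $\eta(\mathring{\mathcal X}_U)\subseteq\operatorname{int}\Xi_W$, where $\Xi_W=\{t\in\mathbb R:A_W(t)<\infty\}$. Affine reversibility condition (imposed only when $\eta$ is affine): write $\eta(u)=\beta_0+\beta_1u$ with $\beta_1\ne0$ and define $$\widetilde b_U(u)=p_U(u)e^{-A_W(\beta_0+\beta_1u)},\qquad \widetilde\Xi_U=\Bigl\{t:\int_{\mathcal X_U}\widetilde b_U(u)e^{tu}\,d\nu_U(u)<\infty\Bigr\}.$$ If $W$ is count, require $\beta_1e\in\operatorname{int}\widetilde\Xi_U$ for each (finite) endpoint $e$ of the support $\mathcal X_W$ (two endpoints for finite support, one for one-sided infinite support). If $W$ is continuous, no additional requirement is imposed. The model class $\mathcal M$ consists of all representations (with graph $X\to Y$, $Y\to X$, or empty) satisfying the regularity above and, when the canonical-parameter function is affine, the affine reversibility condition. *)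

theory Defs
  imports "HOL-Probability.Probability"
begin

datatype variable = Continuous "real set" | Count "int set"

fun valid_variable :: "variable \<Rightarrow> bool" where
  "valid_variable (Continuous S) \<longleftrightarrow> connected S \<and> interior S \<noteq> {}"
| "valid_variable (Count K) \<longleftrightarrow>
     (\<forall>i\<in>K. \<forall>j\<in>K. {i..j} \<subseteq> K) \<and> bdd_below K \<and> (infinite K \<or> 3 \<le> card K)"

(* Dominating measures live on the Borel sets of the whole real line and give no mass to the
   complement of the support; integrals against them are integrals over the support. *)
fun dominating :: "variable \<Rightarrow> real measure" where
  "dominating (Continuous S) = density lborel (indicator S)"
| "dominating (Count K) = distr (count_space K) borel real_of_int"

(* For a count variable this is the whole support, not the topological interior. *)
fun support_interior :: "variable \<Rightarrow> real set" where
  "support_interior (Continuous S) = interior S"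
| "support_interior (Count K) = real_of_int ` K"

definition support_endpoints :: "int set \<Rightarrow> real set" where
  "support_endpoints K = real_of_int ` {e \<in> K. (\<forall>k\<in>K. e \<le> k) \<or> (\<forall>k\<in>K. k \<le> e)}"

(* Only meant for open S, where the two-sided derivatives are the ones wanted. *)
definition C2_on :: "real set \<Rightarrow> (real \<Rightarrow> real) \<Rightarrow> bool" where
  "C2_on S f \<longleftrightarrow>
     (\<exists>f'. (\<forall>x\<in>S. (f has_real_derivative f' x) (at x)) \<and> f' C1_differentiable_on S)"

fun C2_if_continuous :: "variable \<Rightarrow> (real \<Rightarrow> real) \<Rightarrow> bool" where
  "C2_if_continuous (Continuous S) f \<longleftrightarrow> C2_on (interior S) f"
| "C2_if_continuous (Count K) f \<longleftrightarrow> True"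

definition regular_density :: "variable \<Rightarrow> (real \<Rightarrow> real) \<Rightarrow> bool" where
  "regular_density Z f \<longleftrightarrow>
     (\<forall>z\<in>support_interior Z. 0 < f z) \<and> C2_if_continuous Z (\<lambda>z. ln (f z))"

definition partition_integral :: "variable \<Rightarrow> (real \<Rightarrow> real) \<Rightarrow> real \<Rightarrow> ennreal" where
  "partition_integral Z b t = (\<integral>\<^sup>+ z. ennreal (b z * exp (z * t)) \<partial>dominating Z)"

(* The log-partition function is real-valued here, so it is meaningful only on the natural
   parameter set, where the integral is finite; off that set its value is junk. *)
definition log_partition :: "variable \<Rightarrow> (real \<Rightarrow> real) \<Rightarrow> real \<Rightarrow> real" where
  "log_partition Z b t = ln (enn2real (partition_integral Z b t))"

definition natural_parameters :: "variable \<Rightarrow> (real \<Rightarrow> real) \<Rightarrow> real set" where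
  "natural_parameters Z b = {t. partition_integral Z b t < \<infinity>}"

(* The values of a density at boundary points of a continuous support are irrelevant, since
   those points are null; only the values on the support interiors are pinned down. *)
definition joint_density ::
  "variable \<Rightarrow> variable \<Rightarrow> (real \<times> real) measure \<Rightarrow> (real \<times> real \<Rightarrow> real) \<Rightarrow> bool" where
  "joint_density X Y P p \<longleftrightarrow>
     p \<in> borel_measurable borel \<and>
     P = density (dominating X \<Otimes>\<^sub>M dominating Y) (\<lambda>z. ennreal (p z)) \<and>
     (\<forall>x\<in>support_interior X. \<forall>y\<in>support_interior Y. 0 < p (x, y))"

(* Below, q u w is the joint density with the coordinate of U (the source) as first argument,
   whichever of the two variables U is. *)
definition marginal_density ::
  "variable \<Rightarrow> variable \<Rightarrow> (real \<Rightarrow> real \<Rightarrow> real) \<Rightarrow> (real \<Rightarrow> real) \<Rightarrow> bool" where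
  "marginal_density U W q pU \<longleftrightarrow>
     (\<forall>u\<in>support_interior U. ennreal (pU u) = (\<integral>\<^sup>+ w. ennreal (q u w) \<partial>dominating W))"

definition glm_factorization ::
  "variable \<Rightarrow> variable \<Rightarrow> (real \<Rightarrow> real \<Rightarrow> real)
    \<Rightarrow> (real \<Rightarrow> real) \<Rightarrow> (real \<Rightarrow> real) \<Rightarrow> (real \<Rightarrow> real) \<Rightarrow> bool" where
  "glm_factorization U W q pU b \<eta> \<longleftrightarrow>
     marginal_density U W q pU \<and>
     \<not> \<eta> constant_on support_interior U \<and>
     (\<forall>u\<in>support_interior U. \<forall>w\<in>support_interior W.
        q u w = pU u * b w * exp (w * \<eta> u - log_partition W b (\<eta> u)))"

definition regular_glm ::
  "variable \<Rightarrow> variable \<Rightarrow> (real \<Rightarrow> real) \<Rightarrow> (real \<Rightarrow> real) \<Rightarrow> (real \<Rightarrow> real) \<Rightarrow> bool" where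
  "regular_glm U W pU b \<eta> \<longleftrightarrow>
     regular_density U pU \<and> regular_density W b \<and> C2_if_continuous U \<eta> \<and>
     \<eta> ` support_interior U \<subseteq> interior (natural_parameters W b)"

definition affine_on :: "real set \<Rightarrow> (real \<Rightarrow> real) \<Rightarrow> bool" where
  "affine_on S \<eta> \<longleftrightarrow> (\<exists>\<beta>\<^sub>0 \<beta>\<^sub>1. \<forall>u\<in>S. \<eta> u = \<beta>\<^sub>0 + \<beta>\<^sub>1 * u)"

definition tilted_base ::
  "variable \<Rightarrow> (real \<Rightarrow> real) \<Rightarrow> (real \<Rightarrow> real) \<Rightarrow> real \<Rightarrow> real \<Rightarrow> real \<Rightarrow> real" where
  "tilted_base W pU b \<beta>\<^sub>0 \<beta>\<^sub>1 u = pU u * exp (- log_partition W b (\<beta>\<^sub>0 + \<beta>\<^sub>1 * u))"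

(* Vacuous when the canonical-parameter function is not affine; when it is affine and
   nonconstant, the coefficients are unique because the support interior has two points. *)
definition affine_reversible ::
  "variable \<Rightarrow> variable \<Rightarrow> (real \<Rightarrow> real) \<Rightarrow> (real \<Rightarrow> real) \<Rightarrow> (real \<Rightarrow> real) \<Rightarrow> bool" where
  "affine_reversible U W pU b \<eta> \<longleftrightarrow>
     (\<forall>\<beta>\<^sub>0 \<beta>\<^sub>1. \<beta>\<^sub>1 \<noteq> 0 \<and> (\<forall>u\<in>support_interior U. \<eta> u = \<beta>\<^sub>0 + \<beta>\<^sub>1 * u) \<longrightarrow>
        (case W of
           Continuous S \<Rightarrow> True
         | Count K \<Rightarrow> \<forall>e\<in>support_endpoints K.
             \<beta>\<^sub>1 * e \<in> interior (natural_parameters U (tilted_base W pU b \<beta>\<^sub>0 \<beta>\<^sub>1))))"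

definition admissible_edge ::
  "variable \<Rightarrow> variable \<Rightarrow> (real \<Rightarrow> real \<Rightarrow> real)
    \<Rightarrow> (real \<Rightarrow> real) \<Rightarrow> (real \<Rightarrow> real) \<Rightarrow> (real \<Rightarrow> real) \<Rightarrow> bool" where
  "admissible_edge U W q pU b \<eta> \<longleftrightarrow>
     glm_factorization U W q pU b \<eta> \<and> regular_glm U W pU b \<eta> \<and> affine_reversible U W pU b \<eta>"

definition admissible_empty ::
  "variable \<Rightarrow> variable \<Rightarrow> (real \<Rightarrow> real \<Rightarrow> real) \<Rightarrow> (real \<Rightarrow> real) \<Rightarrow> (real \<Rightarrow> real) \<Rightarrow> bool" where
  "admissible_empty X Y q pX pY \<longleftrightarrow>
     marginal_density X Y q pX \<and> marginal_density Y X (\<lambda>y x. q x y) pY \<and>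
     (\<forall>x\<in>support_interior X. \<forall>y\<in>support_interior Y. q x y = pX x * pY y) \<and>
     regular_density X pX \<and> regular_density Y pY"

datatype graph = X_to_Y | Y_to_X | Empty

(* Edge representations list the source density, the base function of the target and the
   canonical-parameter function, in this order. *)
datatype representation =
    Rep_XY "real \<Rightarrow> real" "real \<Rightarrow> real" "real \<Rightarrow> real"
  | Rep_YX "real \<Rightarrow> real" "real \<Rightarrow> real" "real \<Rightarrow> real"
  | Rep_Empty "real \<Rightarrow> real" "real \<Rightarrow> real"

fun graph_of :: "representation \<Rightarrow> graph" where
  "graph_of (Rep_XY pX b \<eta>) = X_to_Y"
| "graph_of (Rep_YX pY b \<eta>) = Y_to_X"
| "graph_of (Rep_Empty pX pY) = Empty"

fun admissible :: "variable \<Rightarrow> variable \<Rightarrow> (real \<times> real \<Rightarrow> real) \<Rightarrow> representation \<Rightarrow> bool" where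
  "admissible X Y p (Rep_XY pX b \<eta>) \<longleftrightarrow> admissible_edge X Y (\<lambda>x y. p (x, y)) pX b \<eta>"
| "admissible X Y p (Rep_YX pY b \<eta>) \<longleftrightarrow> admissible_edge Y X (\<lambda>y x. p (x, y)) pY b \<eta>"
| "admissible X Y p (Rep_Empty pX pY) \<longleftrightarrow> admissible_empty X Y (\<lambda>x y. p (x, y)) pX pY"

(* The joint density is unique only almost everywhere, so each representation of P may
   factorize its own version of it. *)
definition model_class ::
  "variable \<Rightarrow> variable \<Rightarrow> (real \<times> real) measure \<Rightarrow> representation set" where
  "model_class X Y P = {R. \<exists>p. joint_density X Y P p \<and> admissible X Y p R}"

definition identifiable_X_to_Y ::
  "variable \<Rightarrow> variable \<Rightarrow> (real \<times> real) measure \<Rightarrow> bool" where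
  "identifiable_X_to_Y X Y P \<longleftrightarrow> (\<forall>R\<in>model_class X Y P. graph_of R = X_to_Y)"

end

theory Submission
  imports Defs
begin

text \<open>If \<open>P\<close> also factorizes along \<open>Y \<rightarrow> X\<close> (or with the empty graph, which is the case \<open>\<zeta> = 0\<close>),
  comparing logarithms gives \<open>y * \<eta> x - x * \<zeta> y = F x + G y\<close> almost everywhere; fixing two values
  of \<open>y\<close> and subtracting shows that \<open>\<eta>\<close> is affine.

  Conversely, if \<open>\<eta> x = \<beta>\<^sub>0 + \<beta>\<^sub>1 * x\<close>, the cross term of the exponent is \<open>\<beta>\<^sub>1 * x * y\<close>, so the density
  can be read as a model with edge \<open>Y \<rightarrow> X\<close>, parameter function \<open>\<beta>\<^sub>1 * y\<close>, base function
  \<open>pX x * exp (- A (\<beta>\<^sub>0 + \<beta>\<^sub>1 * x))\<close> and source density proportional to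
  \<open>bY y * exp (\<beta>\<^sub>0 * y)\<close>. By Tonelli its partition integral at \<open>\<beta>\<^sub>1 * y\<close> is finite for almost all \<open>y\<close>,
  hence at interior points of the natural parameter interval, except at endpoints of a count
  support, where this is what the affine reversibility condition supplies. Smoothness of the new
  source density and base function comes from differentiating partition integrals under the
  integral sign.\<close>

subsection \<open>Dominating measures\<close>

lemma sets_dominating [measurable_cong, simp]: "sets (dominating Z) = sets borel"
  by (cases Z) auto

lemma space_dominating [simp]: "space (dominating Z) = UNIV"
  by (cases Z) auto

lemma valid_Continuous_borel:
  assumes "valid_variable (Continuous S)"
  shows "S \<in> sets borel"
  using assms by (intro real_interval_borel_measurable) (simp add: is_interval_connected_1)

lemma support_interior_borel [measurable]: "support_interior Z \<in> sets borel"
proof (cases Z)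
  case (Count K)
  have "countable (real_of_int ` K)" by simp
  then show ?thesis unfolding Count support_interior.simps by (rule sets.countable[rotated]) auto
qed auto

lemma AE_dominating_Count_iff:
  assumes [measurable]: "Measurable.pred borel Q"
  shows "(AE z in dominating (Count K). Q z) \<longleftrightarrow> (\<forall>k\<in>K. Q (real_of_int k))"
  unfolding dominating.simps by (subst AE_distr_iff) (auto simp: AE_count_space)

text \<open>Points of a count support are atoms. Pulling a null set back along
  \<open>real_of_int\<close> works for predicates of unknown measurability, such as equations
  between arbitrary base functions.\<close>

lemma AE_dominating_CountD:
  assumes "AE z in dominating (Count K). Q z" and "k \<in> K"
  shows "Q (real_of_int k)"
proof -
  have "AE k in count_space K. Q (real_of_int k)"
    by (rule AE_distrD[where M' = borel and f = real_of_int and P = Q]) (use assms(1) in \<open>auto simp only: dominating.simps measurable_count_space_eq1 space_borel UNIV_I\<close>)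
  with \<open>k \<in> K\<close> show ?thesis by (simp add: AE_count_space)
qed

lemma AE_support_interior:
  assumes "valid_variable Z"
  shows "AE z in dominating Z. z \<in> support_interior Z"
proof (cases Z)
  case (Continuous S)
  have S: "S \<in> sets borel" "connected S"
    using assms valid_Continuous_borel Continuous by auto
  \<comment> \<open>A real interval is convex, and the frontier of a convex set is Lebesgue
    negligible.\<close>
  have "negligible (S - interior S)"
  proof (rule negligible_subset)
    show "negligible (frontier S)"
      using S by (intro negligible_convex_frontier is_interval_convex) (simp add: is_interval_connected_1)
    show "S - interior S \<subseteq> frontier S"
      using closure_subset[of S] by (auto simp: frontier_def)
  qed
  then have "S - interior S \<in> null_sets lborel"
    using S by (auto simp: negligible_iff_null_sets null_sets_completion_iff)
  then have "AE z in lborel. z \<notin> S - interior S" by (rule AE_not_in)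
  with S show ?thesis unfolding Continuous dominating.simps
    by (simp add: AE_density indicator_def)
next
  case (Count K)
  have "Measurable.pred borel (\<lambda>z. z \<in> support_interior (Count K))" by measurable
  then show ?thesis unfolding Count by (subst AE_dominating_Count_iff) auto
qed

lemma sigma_finite_dominating:
  assumes "valid_variable Z"
  shows "sigma_finite_measure (dominating Z)"
proof (cases Z)
  case (Continuous S)
  have "S \<in> sets borel" using assms valid_Continuous_borel Continuous by auto
  then show ?thesis
    by (simp add: Continuous sigma_finite_measure.sigma_finite_iff_density_finite[OF sigma_finite_lborel] indicator_def)
next
  case (Count K)
  \<comment> \<open>Each integer singleton has measure at most one and the complement of the
    integers has measure zero, so these countably many sets witness sigma-finiteness.\<close>
  let ?A = "insert (- range real_of_int) (range (\<lambda>k. {real_of_int k}))"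
  have 1: "(- range real_of_int :: real set) \<in> sets borel"
    by (intro borel_comp) (use support_interior_borel[of "Count UNIV"] in simp)
  have "emeasure (dominating Z) a \<noteq> \<infinity>" if "a \<in> ?A" for a
  proof -
    have "finite (real_of_int -` a \<inter> K)"
      using that by (auto simp: vimage_def Collect_conv_if intro: finite_subset[of _ "{_}"])
    moreover have "a \<in> sets borel" using that 1 by auto
    ultimately show ?thesis
      by (simp add: Count emeasure_distr)
  qed
  moreover have "countable ?A" "?A \<subseteq> sets (dominating Z)" "\<Union>?A = space (dominating Z)"
    using 1 by auto
  ultimately show ?thesis by (intro sigma_finite_measure.intro exI[of _ ?A]) blast
qed

text \<open>A nonempty open set has positive Lebesgue measure, so it must meet any property that
  holds almost everywhere on the support.\<close>

lemma AE_dominating_ContinuousD: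
  assumes "valid_variable (Continuous S)" and "AE z in dominating (Continuous S). Q z"
    and "open U" "U \<noteq> {}" "U \<subseteq> S"
  shows "\<exists>z\<in>U. Q z"
proof (rule ccontr)
  assume *: "\<not> (\<exists>z\<in>U. Q z)"
  have "AE z in lborel. 0 < (indicator S z :: ennreal) \<longrightarrow> Q z"
    using assms(2) valid_Continuous_borel[OF assms(1)] unfolding dominating.simps
    by (simp add: AE_density)
  then have "AE z in lborel. z \<notin> U"
    by eventually_elim (use * \<open>U \<subseteq> S\<close> in \<open>auto simp: indicator_def\<close>)
  then have "emeasure lborel U = 0"
    using \<open>open U\<close> by (subst (asm) AE_iff_measurable[OF _ refl]) auto
  then have "negligible U"
    using \<open>open U\<close> by (auto simp: negligible_iff_null_sets null_sets_def)
  then show False using \<open>open U\<close> \<open>U \<noteq> {}\<close> open_not_negligible by blast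
qed

lemma valid_Count_two_points:
  assumes "valid_variable (Count K)"
  obtains i j where "i \<in> K" "j \<in> K" "i < j"
proof -
  have "\<not> (\<exists>k. K \<subseteq> {k})"
    using assms card_mono[of "{_}" K] finite_subset[of K "{_}"] by fastforce
  then show thesis using that by (metis linorder_neqE_linordered_idom insertCI subsetI insert_subset)
qed

lemma AE_dominating_two_points:
  assumes "valid_variable Z" and "AE z in dominating Z. Q z"
  obtains z z' where "z \<in> support_interior Z" "z' \<in> support_interior Z" "z < z'" "Q z" "Q z'"
proof (cases Z)
  case (Continuous S)
  have "interior S \<noteq> {}" using assms Continuous by auto
  then obtain x e where e: "e > 0" "ball x e \<subseteq> interior S"
    by (metis ex_in_conv open_contains_ball open_interior)
  then have sub: "{x-e<..<x+e} \<subseteq> interior S" by (simp add: ball_eq_greaterThanLessThan)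
  have "\<exists>z\<in>{x-e<..<x}. Q z" "\<exists>z\<in>{x<..<x+e}. Q z"
    by (rule AE_dominating_ContinuousD[of S]; use assms Continuous e sub interior_subset[of S] in force)+
  then obtain z z' where "z \<in> {x-e<..<x}" "Q z" "z' \<in> {x<..<x+e}" "Q z'" by blast
  moreover from this have "z \<in> support_interior Z" "z' \<in> support_interior Z" "z < z'"
    using sub Continuous by auto
  ultimately show thesis using that by blast
next
  case (Count K)
  obtain i j where "i \<in> K" "j \<in> K" "i < j"
    using valid_Count_two_points assms(1) Count by blast
  then show thesis
    using that[of "real_of_int i" "real_of_int j"] assms(2)[unfolded Count] AE_dominating_CountD[of Q K] by (simp add: Count)
qed

lemma support_interior_two_points:
  assumes "valid_variable Z"
  obtains z z' where "z \<in> support_interior Z" "z' \<in> support_interior Z" "z < z'"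
  using AE_dominating_two_points[OF assms, of "\<lambda>_. True"] by auto

text \<open>In the continuous case the set of disagreement is open, so if nonempty it would contain
  a point of agreement; in the count case every point is an atom.\<close>

lemma AE_eq_imp_eq:
  assumes "valid_variable Z" and "AE z in dominating Z. f z = (g z :: real)"
    and "\<And>S. Z = Continuous S \<Longrightarrow> continuous_on (interior S) f \<and> continuous_on (interior S) g"
    and "z \<in> support_interior Z"
  shows "f z = g z"
proof (cases Z)
  case (Continuous S)
  show ?thesis
  proof (rule ccontr)
    assume "f z \<noteq> g z"
    let ?U = "{x \<in> interior S. f x - g x \<in> - {0}}"
    have "open ?U"
      using assms(3)[OF Continuous]
      by (intro continuous_open_preimage[unfolded vimage_def Int_def, simplified] continuous_intros) auto
    moreover have "z \<in> ?U" using \<open>f z \<noteq> g z\<close> assms(4) Continuous by auto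
    ultimately have "\<exists>x\<in>?U. f x = g x"
      using assms(1,2) Continuous interior_subset[of S] by (intro AE_dominating_ContinuousD[of S]) auto
    then show False by auto
  qed
next
  case (Count K)
  then show ?thesis using assms(2)[unfolded Count] assms(4) AE_dominating_CountD[of "\<lambda>z. f z = g z" K] by auto
qed

text \<open>Good points on both sides of \<open>z\<close> will later place a multiple of
  \<open>z\<close> inside an open interval of natural parameters. Only an endpoint of a count
  support can lack them.\<close>

lemma AE_support_interior_between:
  assumes "valid_variable Z" and "AE z in dominating Z. Q z" and "z \<in> support_interior Z"
  shows "(\<exists>r s. r < z \<and> z < s \<and> Q r \<and> Q s) \<or> (\<exists>K. Z = Count K \<and> z \<in> support_endpoints K)"
proof (cases Z)
  case (Continuous S)
  then obtain e where e: "e > 0" "ball z e \<subseteq> interior S"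
    using assms(3) by (metis open_contains_ball open_interior support_interior.simps(1))
  then have sub: "{z-e<..<z+e} \<subseteq> interior S" by (simp add: ball_eq_greaterThanLessThan)
  have "\<exists>x\<in>{z-e<..<z}. Q x" "\<exists>x\<in>{z<..<z+e}. Q x"
    by (rule AE_dominating_ContinuousD[of S]; use assms Continuous e sub interior_subset[of S] in force)+
  then show ?thesis by auto
next
  case (Count K)
  then obtain k where k: "k \<in> K" "z = real_of_int k" using assms(3) by auto
  show ?thesis
  proof (cases "z \<in> support_endpoints K")
    case True
    then show ?thesis using Count by blast
  next
    case False
    then obtain i j where "i \<in> K" "j \<in> K" "i < k" "k < j"
      using k by (auto simp: support_endpoints_def image_iff not_le)
    then have "real_of_int i < z \<and> z < real_of_int j \<and> Q (real_of_int i) \<and> Q (real_of_int j)"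
      using assms(2)[unfolded Count] AE_dominating_CountD[of Q K] k by simp
    then show ?thesis by blast
  qed
qed

subsection \<open>Twice continuously differentiable functions\<close>

lemma C2_on_iff:
  "C2_on S f \<longleftrightarrow> (\<exists>f' f''. (\<forall>x\<in>S. (f has_real_derivative f' x) (at x)) \<and>
    (\<forall>x\<in>S. (f' has_real_derivative f'' x) (at x)) \<and> continuous_on S f'')"
  unfolding C2_on_def C1_differentiable_on_def has_real_derivative_iff_has_vector_derivative by blast

lemma C2_onI:
  assumes "\<And>x. x \<in> S \<Longrightarrow> (f has_real_derivative f' x) (at x)"
    and "\<And>x. x \<in> S \<Longrightarrow> (f' has_real_derivative f'' x) (at x)"
    and "continuous_on S f''"
  shows "C2_on S f"
  using assms unfolding C2_on_iff by blast

lemma C2_on_imp_continuous_on: "C2_on S f \<Longrightarrow> continuous_on S f"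
  unfolding C2_on_iff by (blast intro: continuous_at_imp_continuous_on DERIV_isCont)

lemma C2_on_add:
  assumes "C2_on S f" "C2_on S g"
  shows "C2_on S (\<lambda>x. f x + g x)"
proof -
  obtain f' f'' where f: "\<And>x. x \<in> S \<Longrightarrow> (f has_real_derivative f' x) (at x)"
    "\<And>x. x \<in> S \<Longrightarrow> (f' has_real_derivative f'' x) (at x)" "continuous_on S f''"
    using assms(1) unfolding C2_on_iff by blast
  obtain g' g'' where g: "\<And>x. x \<in> S \<Longrightarrow> (g has_real_derivative g' x) (at x)"
    "\<And>x. x \<in> S \<Longrightarrow> (g' has_real_derivative g'' x) (at x)" "continuous_on S g''"
    using assms(2) unfolding C2_on_iff by blast
  show ?thesis
    by (rule C2_onI[where f' = "\<lambda>x. f' x + g' x" and f'' = "\<lambda>x. f'' x + g'' x"])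
      (auto intro!: DERIV_add f g continuous_on_add)
qed

lemma C2_on_cmult:
  assumes "C2_on S f"
  shows "C2_on S (\<lambda>x. c * f x)"
proof -
  obtain f' f'' where f: "\<And>x. x \<in> S \<Longrightarrow> (f has_real_derivative f' x) (at x)"
    "\<And>x. x \<in> S \<Longrightarrow> (f' has_real_derivative f'' x) (at x)" "continuous_on S f''"
    using assms(1) unfolding C2_on_iff by blast
  show ?thesis
    by (rule C2_onI[where f' = "\<lambda>x. c * f' x" and f'' = "\<lambda>x. c * f'' x"])
      (auto intro!: DERIV_cmult f continuous_on_mult_left)
qed

lemma C2_on_ident: "C2_on S (\<lambda>x. x)"
  by (rule C2_onI[where f' = "\<lambda>_. 1" and f'' = "\<lambda>_. 0"]) auto

lemma C2_on_affine_compose: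
  assumes "C2_on T f" and "\<And>x. x \<in> S \<Longrightarrow> a + c * x \<in> T"
  shows "C2_on S (\<lambda>x. f (a + c * x))"
proof -
  obtain f' f'' where f: "\<And>x. x \<in> T \<Longrightarrow> (f has_real_derivative f' x) (at x)"
    "\<And>x. x \<in> T \<Longrightarrow> (f' has_real_derivative f'' x) (at x)" "continuous_on T f''"
    using assms(1) unfolding C2_on_iff by blast
  have d: "((\<lambda>x. a + c * x) has_real_derivative c) (at x)" for x
    by (auto intro!: derivative_eq_intros)
  have d1: "((\<lambda>x. f (a + c * x)) has_real_derivative f' (a + c * x) * c) (at x)" if "x \<in> S" for x
    using DERIV_chain2[OF f(1)[OF assms(2)[OF that]] d] .
  have d2: "((\<lambda>x. f' (a + c * x) * c) has_real_derivative f'' (a + c * x) * c * c) (at x)" if "x \<in> S" for x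
    using DERIV_cmult_right[OF DERIV_chain2[OF f(2)[OF assms(2)[OF that]] d]] .
  have "continuous_on S (\<lambda>x. f'' (a + c * x) * c * c)"
    by (intro continuous_on_mult continuous_on_const continuous_on_compose2[OF f(3)]
        continuous_on_add continuous_on_id) (use assms(2) in auto)
  with d1 d2 show ?thesis by (rule C2_onI)
qed

lemma C2_on_cong:
  assumes "open S" and "C2_on S f" and "\<And>x. x \<in> S \<Longrightarrow> f x = g x"
  shows "C2_on S g"
proof -
  obtain f' f'' where f: "\<And>x. x \<in> S \<Longrightarrow> (f has_real_derivative f' x) (at x)"
    "\<And>x. x \<in> S \<Longrightarrow> (f' has_real_derivative f'' x) (at x)" "continuous_on S f''"
    using assms(2) unfolding C2_on_iff by blast
  show ?thesis
  proof (rule C2_onI[OF _ f(2,3)])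
    fix x assume "x \<in> S"
    then show "(g has_real_derivative f' x) (at x)"
      by (rule has_field_derivative_transform_within_open[OF f(1) assms(1)]) (use \<open>x \<in> S\<close> assms(3) in auto)
  qed
qed

subsection \<open>Partition integrals\<close>

text \<open>Controls difference quotients of exponentials. Both signs come from
  \<open>1 + x \<le> exp x\<close>, applied to \<open>- x\<close> when
  \<open>x \<ge> 0\<close>.\<close>

lemma abs_exp_minus_one_le:
  fixes x :: real
  shows "\<bar>exp x - 1\<bar> \<le> \<bar>x\<bar> * exp \<bar>x\<bar>"
proof (cases "x \<ge> 0")
  case True
  have "exp x * (1 - x) \<le> exp x * exp (- x)"
    using exp_ge_add_one_self[of "- x"] by (intro mult_left_mono) auto
  then show ?thesis
    using True by (simp add: exp_minus algebra_simps)
next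
  case False
  have "1 * (- x) \<le> exp (- x) * (- x)"
    using False by (intro mult_right_mono) auto
  moreover have "1 - exp x \<le> - x"
    using exp_ge_add_one_self[of x] by linarith
  ultimately have "1 - exp x \<le> exp (- x) * (- x)" by linarith
  with False show ?thesis by (simp add: abs_if mult.commute)
qed

text \<open>Dominated convergence for the difference quotients in \<open>t\<close>. The factor
  \<open>g\<close> may have any sign, so the result can be reapplied to \<open>z * g z\<close> and
  gives derivatives of every order.\<close>

lemma has_real_derivative_integral_exp:
  fixes M :: "real measure" and g :: "real \<Rightarrow> real"
  assumes M[measurable_cong]: "sets M = sets borel" and g[measurable]: "g \<in> borel_measurable borel"
    and "open U" and int: "\<And>t. t \<in> U \<Longrightarrow> integrable M (\<lambda>z. g z * exp (z * t))" and "t \<in> U"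
  shows "integrable M (\<lambda>z. z * g z * exp (z * t))"
    and "((\<lambda>t. \<integral>z. g z * exp (z * t) \<partial>M) has_real_derivative
          (\<integral>z. z * g z * exp (z * t) \<partial>M)) (at t)"
proof -
  obtain r where r: "r > 0" "ball t r \<subseteq> U"
    using \<open>open U\<close> \<open>t \<in> U\<close> by (rule openE)
  \<comment> \<open>A third of the radius keeps both \<open>t + 2 * d\<close> and
    \<open>t - 2 * d\<close> inside \<open>U\<close>.\<close>
  define d where "d = r / 3"
  have d: "d > 0" using r by (simp add: d_def)
  have U: "t + h \<in> U" if "\<bar>h\<bar> \<le> 2 * d" for h
    using r that by (auto simp: d_def dist_real_def subset_eq)
  \<comment> \<open>This dominates the difference quotients \<open>s h\<close>: one \<open>d\<close>
    in the exponents pays for the increment \<open>h\<close>, the other for the factor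
    \<open>\<bar>z\<bar>\<close>, since
    \<open>\<bar>z\<bar> * d \<le> exp (\<bar>z\<bar> * d)\<close>.\<close>
  define w where "w z = (1 / d) * (\<bar>g z * exp (z * (t + 2 * d))\<bar> + \<bar>g z * exp (z * (t - 2 * d))\<bar>)" for z
  define s where "s h z = g z * exp (z * t) * ((exp (z * h) - 1) / h)" for h z
  have w: "integrable M w"
    unfolding w_def using U[of "2 * d"] U[of "- 2 * d"] d
    by (intro integrable_mult_right Bochner_Integration.integrable_add integrable_abs int) auto
  have bound: "norm (s h z) \<le> w z" if h: "h \<in> {-d<..<d} - {0}" for h z
  proof -
    have "\<bar>(exp (z * h) - 1) / h\<bar> \<le> \<bar>z\<bar> * exp (\<bar>z\<bar> * \<bar>h\<bar>)"
      using abs_exp_minus_one_le[of "z * h"] h by (simp add: abs_mult field_simps)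
    also have "\<dots> \<le> \<bar>z\<bar> * exp (\<bar>z\<bar> * d)"
      using h by (intro mult_left_mono) (auto intro!: mult_left_mono)
    also have "\<dots> = (1 / d) * ((\<bar>z\<bar> * d) * exp (\<bar>z\<bar> * d))"
      using d by simp
    also have "\<dots> \<le> (1 / d) * (exp (\<bar>z\<bar> * d) * exp (\<bar>z\<bar> * d))"
      using d order_trans[OF _ exp_ge_add_one_self[of "\<bar>z\<bar> * d"]] by (intro mult_left_mono mult_right_mono) auto
    also have "\<dots> = (1 / d) * exp (\<bar>z\<bar> * (2 * d))"
      by (simp flip: exp_add)
    also have "\<dots> \<le> (1 / d) * (exp (z * (2 * d)) + exp (z * (- 2 * d)))"
      using d by (intro mult_left_mono) (auto simp: abs_if)
    finally have "\<bar>g z * exp (z * t)\<bar> * \<bar>(exp (z * h) - 1) / h\<bar> \<le>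
        \<bar>g z * exp (z * t)\<bar> * ((1 / d) * (exp (z * (2 * d)) + exp (z * (- 2 * d))))"
      by (intro mult_left_mono) auto
    also have "\<dots> = w z"
      by (simp add: w_def abs_mult algebra_simps flip: exp_add)
    finally show ?thesis by (simp add: s_def abs_mult)
  qed
  have lim: "(\<lambda>i. s (h i) z) \<longlonglongrightarrow> z * g z * exp (z * t)"
    if "\<And>i. h i \<in> {-d<..<d} - {0}" "h \<longlonglongrightarrow> 0" for h z
  proof -
    have "((\<lambda>h. exp (z * h)) has_real_derivative z) (at 0)"
      by (auto intro!: derivative_eq_intros)
    then have "((\<lambda>h. (exp (z * h) - 1) / h) \<longlongrightarrow> z) (at 0 within {-d<..<d})"
      using d by (subst at_within_open) (auto simp: DERIV_def)
    then have "(\<lambda>i. (exp (z * h i) - 1) / h i) \<longlonglongrightarrow> z"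
      using that unfolding tendsto_at_iff_sequentially by (auto simp: o_def)
    then have "(\<lambda>i. s (h i) z) \<longlonglongrightarrow> g z * exp (z * t) * z"
      unfolding s_def by (intro tendsto_intros)
    then show ?thesis by (simp add: mult_ac)
  qed
  have [measurable]: "s h \<in> borel_measurable M" for h unfolding s_def by measurable
  \<comment> \<open>A concrete nonzero null sequence, from which the limit inherits integrability;
    the 2 keeps even the first term strictly below \<open>d\<close>.\<close>
  define h0 where "h0 i = d / (real i + 2)" for i
  have h0: "h0 i \<in> {-d<..<d} - {0}" for i
  proof -
    have "d * 1 < d * (real i + 2)" using d by (intro mult_strict_left_mono) auto
    then show ?thesis using d by (auto simp: h0_def field_simps)
  qed
  have h0l: "h0 \<longlonglongrightarrow> 0"
  proof -
    have "filterlim (\<lambda>i. 2 + real i) at_top sequentially"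
      by (rule filterlim_tendsto_add_at_top[OF tendsto_const filterlim_real_sequentially])
    then show ?thesis
      unfolding h0_def by (intro real_tendsto_divide_at_top[OF tendsto_const]) (simp add: add.commute)
  qed
  show "integrable M (\<lambda>z. z * g z * exp (z * t))"
    by (rule integrable_dominated_convergence[where s = "\<lambda>i. s (h0 i)" and w = w])
      (use w lim[OF h0 h0l] bound[OF h0] in auto)
  have eq: "(\<integral>z. g z * exp (z * (t + h)) \<partial>M) - (\<integral>z. g z * exp (z * t) \<partial>M) = h * (\<integral>z. s h z \<partial>M)"
    if "h \<in> {-d<..<d} - {0}" for h
  proof -
    have "(\<integral>z. g z * exp (z * (t + h)) \<partial>M) - (\<integral>z. g z * exp (z * t) \<partial>M) =
        (\<integral>z. g z * exp (z * (t + h)) - g z * exp (z * t) \<partial>M)"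
      using that U[of h] \<open>t \<in> U\<close> by (intro Bochner_Integration.integral_diff[symmetric] int) auto
    also have "\<dots> = (\<integral>z. h * s h z \<partial>M)"
      using that by (intro Bochner_Integration.integral_cong) (auto simp: s_def field_simps exp_add)
    finally show ?thesis by simp
  qed
  \<comment> \<open>Confining \<open>h\<close> to an open window around 0 leaves the limit unchanged
    and makes the bound valid for all terms of every sequence testing it.\<close>
  have "((\<lambda>h. ((\<integral>z. g z * exp (z * (t + h)) \<partial>M) - (\<integral>z. g z * exp (z * t) \<partial>M)) / h)
      \<longlongrightarrow> (\<integral>z. z * g z * exp (z * t) \<partial>M)) (at 0 within {-d<..<d})"
    unfolding tendsto_at_iff_sequentially o_def
  proof (intro allI impI)
    fix h :: "nat \<Rightarrow> real" assume h: "\<forall>i. h i \<in> {-d<..<d} - {0}" "h \<longlonglongrightarrow> 0"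
    have "(\<lambda>i. \<integral>z. s (h i) z \<partial>M) \<longlonglongrightarrow> (\<integral>z. z * g z * exp (z * t) \<partial>M)"
      by (rule integral_dominated_convergence[where w = w]) (use w lim[of h] h bound in auto)
    then show "(\<lambda>i. ((\<integral>z. g z * exp (z * (t + h i)) \<partial>M) - (\<integral>z. g z * exp (z * t) \<partial>M)) / h i)
        \<longlonglongrightarrow> (\<integral>z. z * g z * exp (z * t) \<partial>M)"
      by (rule Lim_transform_eventually) (use h(1) eq in auto)
  qed
  then show "((\<lambda>t. \<integral>z. g z * exp (z * t) \<partial>M) has_real_derivative
          (\<integral>z. z * g z * exp (z * t) \<partial>M)) (at t)"
    using d by (subst (asm) at_within_open) (auto simp: DERIV_def)
qed

lemma partition_integral_cong:
  assumes "valid_variable Z" and "\<And>z. z \<in> support_interior Z \<Longrightarrow> b z = c z"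
  shows "partition_integral Z b t = partition_integral Z c t"
  unfolding partition_integral_def
  by (rule nn_integral_cong_AE, use AE_support_interior[OF assms(1)] in eventually_elim) (simp add: assms(2))

lemma partition_integral_tilt:
  "partition_integral Z (\<lambda>z. b z * exp (a * z)) t = partition_integral Z b (a + t)"
  unfolding partition_integral_def by (intro nn_integral_cong) (simp add: algebra_simps exp_add)

text \<open>Values of a base function off the support interior are arbitrary, possibly non-measurable,
  so integrals are computed with the base function cut off to the support interior.\<close>
definition cutoff :: "variable \<Rightarrow> (real \<Rightarrow> real) \<Rightarrow> real \<Rightarrow> real" where
  "cutoff Z b z = indicator (support_interior Z) z * b z"

lemma cutoff_eq [simp]: "z \<in> support_interior Z \<Longrightarrow> cutoff Z b z = b z"
  by (simp add: cutoff_def)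

lemma cutoff_nonneg: "regular_density Z b \<Longrightarrow> 0 \<le> cutoff Z b z"
  by (auto simp: cutoff_def regular_density_def indicator_def less_imp_le)

lemma cutoff_measurable:
  assumes "regular_density Z b"
  shows "cutoff Z b \<in> borel_measurable borel"
proof (cases Z)
  case (Continuous S)
  then have "continuous_on (interior S) (\<lambda>z. ln (b z))"
    using assms C2_on_imp_continuous_on by (auto simp: regular_density_def)
  \<comment> \<open>Regularity gives smoothness of \<open>ln b\<close> only; positivity recovers
    \<open>b\<close> by exponentiating.\<close>
  then have "continuous_on (interior S) (\<lambda>z. exp (ln (b z)))"
    by (rule continuous_on_exp)
  then have "continuous_on (interior S) b"
    by (rule continuous_on_eq) (use assms Continuous in \<open>auto simp: regular_density_def\<close>)
  then have "(\<lambda>z. indicator (interior S) z *\<^sub>R b z) \<in> borel_measurable borel"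
    by (intro borel_measurable_continuous_on_indicator) auto
  moreover have "cutoff Z b = (\<lambda>z. indicator (interior S) z *\<^sub>R b z)"
    by (auto simp: cutoff_def Continuous)
  ultimately show ?thesis by simp
next
  case (Count K)
  \<comment> \<open>The cutoff differs from zero at most on a countable set.\<close>
  show ?thesis
    by (rule measurable_discrete_difference[where X = "real_of_int ` K" and f = "\<lambda>_. 0"])
      (auto simp: cutoff_def Count)
qed

lemma partition_integral_cutoff:
  "valid_variable Z \<Longrightarrow> partition_integral Z b t = (\<integral>\<^sup>+ z. ennreal (cutoff Z b z * exp (z * t)) \<partial>dominating Z)"
  using partition_integral_cong[of Z "cutoff Z b" b t] by (simp add: partition_integral_def)

text \<open>The integrand is positive on the support interior, which is not null. This keeps the
  logarithm in \<open>log_partition\<close> away from its default value at 0.\<close>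

lemma partition_integral_nonzero:
  assumes "valid_variable Z" "regular_density Z b"
  shows "partition_integral Z b t \<noteq> 0"
proof
  note [measurable] = cutoff_measurable[OF assms(2)]
  assume "partition_integral Z b t = 0"
  then have "AE z in dominating Z. ennreal (cutoff Z b z * exp (z * t)) = 0"
    unfolding partition_integral_cutoff[OF assms(1)] by (subst (asm) nn_integral_0_iff_AE) auto
  then obtain z where "z \<in> support_interior Z" "ennreal (cutoff Z b z * exp (z * t)) = 0"
    by (rule AE_dominating_two_points[OF assms(1)])
  with assms(2) show False
    by (auto simp: regular_density_def ennreal_eq_0_iff mult_le_0_iff not_le)
qed

lemma exp_log_partition:
  assumes "valid_variable Z" "regular_density Z b" "t \<in> natural_parameters Z b"
  shows "ennreal (exp (log_partition Z b t)) = partition_integral Z b t"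
proof -
  have "0 < enn2real (partition_integral Z b t)"
    using assms partition_integral_nonzero[OF assms(1,2)]
    by (auto simp: enn2real_positive_iff natural_parameters_def zero_less_iff_neq_zero)
  then show ?thesis
    using assms(3) by (simp add: log_partition_def natural_parameters_def)
qed

lemma natural_parameters_iff_integrable:
  assumes "valid_variable Z" "regular_density Z b"
  shows "t \<in> natural_parameters Z b \<longleftrightarrow> integrable (dominating Z) (\<lambda>z. cutoff Z b z * exp (z * t))"
proof -
  note [measurable] = cutoff_measurable[OF assms(2)]
  show ?thesis
    using cutoff_nonneg[OF assms(2)]
    by (simp add: natural_parameters_def partition_integral_cutoff[OF assms(1)] integrable_iff_bounded abs_mult)
qed

lemma log_partition_eq_integral:
  assumes "valid_variable Z" "regular_density Z b"
  shows "log_partition Z b t = ln (\<integral>z. cutoff Z b z * exp (z * t) \<partial>dominating Z)"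
proof -
  note [measurable] = cutoff_measurable[OF assms(2)]
  show ?thesis
    using cutoff_nonneg[OF assms(2)]
    by (simp add: log_partition_def partition_integral_cutoff[OF assms(1)] integral_eq_nn_integral)
qed

text \<open>For each sign of \<open>z\<close>, \<open>exp (z * s)\<close> is monotone in
  \<open>s\<close>, so it is at most the sum of its values at the two outer parameters.\<close>

lemma natural_parameters_between:
  assumes "valid_variable Z" "regular_density Z b"
    and "r \<in> natural_parameters Z b" "t \<in> natural_parameters Z b" "r \<le> s" "s \<le> t"
  shows "s \<in> natural_parameters Z b"
proof -
  note [measurable] = cutoff_measurable[OF assms(2)]
  have exp_le: "exp (z * s) \<le> exp (z * r) + exp (z * t)" for z
  proof (cases "z \<ge> 0")
    case True
    then have "exp (z * s) \<le> exp (z * t)" using assms by (auto intro: mult_left_mono)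
    then show ?thesis by (simp add: add_increasing)
  next
    case False
    then have "exp (z * s) \<le> exp (z * r)" using assms by (auto intro: mult_left_mono_neg)
    then show ?thesis by (simp add: add_increasing2)
  qed
  have "integrable (dominating Z) (\<lambda>z. cutoff Z b z * exp (z * r) + cutoff Z b z * exp (z * t))"
    using assms by (auto simp: natural_parameters_iff_integrable)
  then have "integrable (dominating Z) (\<lambda>z. cutoff Z b z * exp (z * s))"
    by (rule Bochner_Integration.integrable_bound)
      (auto simp: abs_mult cutoff_nonneg[OF assms(2)] simp flip: distrib_left intro!: mult_left_mono exp_le)
  then show ?thesis by (simp add: natural_parameters_iff_integrable assms)
qed

lemma natural_parameters_interior:
  assumes "valid_variable Z" "regular_density Z b"
    and "r \<in> natural_parameters Z b" "t \<in> natural_parameters Z b" "r < s" "s < t"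
  shows "s \<in> interior (natural_parameters Z b)"
proof -
  have "{r<..<t} \<subseteq> interior (natural_parameters Z b)"
    by (intro interior_maximal) (use natural_parameters_between[OF assms(1-4)] in auto)
  then show ?thesis using assms by auto
qed

lemma C2_on_log_partition:
  assumes "valid_variable Z" "regular_density Z b"
  shows "C2_on (interior (natural_parameters Z b)) (log_partition Z b)"
proof -
  let ?U = "interior (natural_parameters Z b)"
  \<comment> \<open>On \<open>?U\<close> this is the \<open>k\<close>-th derivative of the partition
    function, an unnormalised moment; the derivatives of its logarithm below are the mean and the
    variance.\<close>
  define I where "I k t = (\<integral>z. z ^ k * cutoff Z b z * exp (z * t) \<partial>dominating Z)" for k :: nat and t
  note [measurable] = cutoff_measurable[OF assms(2)]
  have int: "integrable (dominating Z) (\<lambda>z. z ^ k * cutoff Z b z * exp (z * t))" if "t \<in> ?U" for k t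
    using that
  proof (induction k arbitrary: t)
    case 0
    then show ?case
      using interior_subset natural_parameters_iff_integrable[OF assms] by auto
  next
    case (Suc k)
    \<comment> \<open>Differentiation under the integral with \<open>z ^ k * cutoff Z b z\<close> in
      the role of \<open>g\<close> also yields integrability of the next moment.\<close>
    show ?case
      using has_real_derivative_integral_exp(1)[OF _ _ open_interior Suc.IH Suc.prems, simplified]
      by (simp add: mult.assoc)
  qed
  have DI: "(I k has_real_derivative I (Suc k) t) (at t)" if "t \<in> ?U" for k t
    using has_real_derivative_integral_exp(2)[OF _ _ open_interior int that, simplified, of k]
    by (simp add: I_def[abs_def] mult.assoc)
  have pos: "I 0 t > 0" if "t \<in> ?U" for t
  proof -
    have "t \<in> natural_parameters Z b" using that interior_subset by auto
    then have "ennreal (I 0 t) = partition_integral Z b t"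
      using natural_parameters_iff_integrable[OF assms] cutoff_nonneg[OF assms(2)]
      by (simp add: I_def partition_integral_cutoff assms nn_integral_eq_integral)
    with partition_integral_nonzero[OF assms, of t] show ?thesis
      by (metis ennreal_eq_0_iff not_le)
  qed
  have cont: "continuous_on ?U (I k)" for k
    using DI by (intro continuous_at_imp_continuous_on) (auto intro: DERIV_isCont)
  have eq: "log_partition Z b = (\<lambda>t. ln (I 0 t))"
    using log_partition_eq_integral[OF assms] by (auto simp: I_def)
  show ?thesis
    unfolding eq
  proof (rule C2_onI)
    fix t assume t: "t \<in> ?U"
    show "((\<lambda>t. ln (I 0 t)) has_real_derivative I 1 t / I 0 t) (at t)"
      using DI[OF t, of 0] pos[OF t] by (auto intro!: derivative_eq_intros)
    show "((\<lambda>t. I 1 t / I 0 t) has_real_derivative (I 2 t * I 0 t - I 1 t * I 1 t) / (I 0 t * I 0 t)) (at t)"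
      using DI[OF t, of 0] DI[OF t, of 1] pos[OF t]
      by (auto intro!: derivative_eq_intros simp: numeral_2_eq_2)
  next
    show "continuous_on ?U (\<lambda>t. (I 2 t * I 0 t - I 1 t * I 1 t) / (I 0 t * I 0 t))"
      using pos by (intro continuous_intros cont) (auto simp: less_imp_neq[symmetric])
  qed
qed

subsection \<open>Factorizations of the joint density\<close>

lemma pair_sigma_finite_dominating:
  "valid_variable X \<Longrightarrow> valid_variable Y \<Longrightarrow> pair_sigma_finite (dominating X) (dominating Y)"
  by (intro pair_sigma_finite.intro sigma_finite_dominating)

text \<open>Densities over a sigma-finite product are unique almost everywhere. The quantifiers are
  ordered so that \<open>y\<close> can be fixed first; positivity turns equality in
  \<open>ennreal\<close> into equality of reals.\<close>

lemma joint_density_AE_eq: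
  assumes "valid_variable X" "valid_variable Y" "joint_density X Y P p" "joint_density X Y P p'"
  shows "AE y in dominating Y. AE x in dominating X.
    x \<in> support_interior X \<and> y \<in> support_interior Y \<longrightarrow> p (x, y) = p' (x, y)"
proof -
  interpret XY: pair_sigma_finite "dominating X" "dominating Y"
    by (intro pair_sigma_finite_dominating assms)
  have [measurable]: "p \<in> borel_measurable (borel \<Otimes>\<^sub>M borel)" "p' \<in> borel_measurable (borel \<Otimes>\<^sub>M borel)"
    using assms by (auto simp: joint_density_def borel_prod)
  have "AE z in dominating X \<Otimes>\<^sub>M dominating Y. ennreal (p z) = ennreal (p' z)"
    using assms by (intro XY.density_unique) (auto simp: joint_density_def)
  then have "AE x in dominating X. AE y in dominating Y. ennreal (p (x, y)) = ennreal (p' (x, y))"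
    by (rule XY.AE_pair)
  then have "AE y in dominating Y. AE x in dominating X. ennreal (p (x, y)) = ennreal (p' (x, y))"
    by (subst (asm) XY.AE_commute) measurable
  moreover have "p (x, y) = p' (x, y)"
    if "ennreal (p (x, y)) = ennreal (p' (x, y))" "x \<in> support_interior X" "y \<in> support_interior Y" for x y
    using that assms(3,4) by (subst (asm) ennreal_inj) (auto simp: joint_density_def less_imp_le)
  ultimately show ?thesis
    by (elim eventually_mono) blast
qed

text \<open>By Tonelli these inner integrals integrate to the total mass 1 of \<open>P\<close>, so
  they are finite almost everywhere.\<close>

lemma joint_density_nn_integral:
  assumes "valid_variable X" "valid_variable Y" "prob_space P" "joint_density X Y P p"
  shows "AE y in dominating Y. (\<integral>\<^sup>+ x. ennreal (p (x, y)) \<partial>dominating X) \<noteq> \<infinity>"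
proof -
  interpret XY: pair_sigma_finite "dominating X" "dominating Y"
    by (intro pair_sigma_finite_dominating assms)
  have [measurable]: "p \<in> borel_measurable (borel \<Otimes>\<^sub>M borel)"
    using assms by (auto simp: joint_density_def borel_prod)
  have "(\<integral>\<^sup>+ y. \<integral>\<^sup>+ x. ennreal (p (x, y)) \<partial>dominating X \<partial>dominating Y) =
      (\<integral>\<^sup>+ z. ennreal (p z) \<partial>(dominating X \<Otimes>\<^sub>M dominating Y))"
    by (rule XY.nn_integral_snd) measurable
  also have "\<dots> = emeasure (density (dominating X \<Otimes>\<^sub>M dominating Y) (\<lambda>z. ennreal (p z)))
      (space (dominating X \<Otimes>\<^sub>M dominating Y))"
    by (subst emeasure_density[OF _ sets.top]) (auto intro!: nn_integral_cong)
  also have "\<dots> = emeasure P (space P)"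
    using assms(4) by (auto simp: joint_density_def)
  also have "\<dots> = 1"
    using assms(3) by (rule prob_space.emeasure_space_1)
  finally show ?thesis
    by (intro nn_integral_PInf_AE) auto
qed

text \<open>Subtracting the logarithms of the two factorizations at two values of \<open>y\<close> cancels every
  factor that depends on \<open>x\<close> alone, in particular the log-partition term, whose smoothness
  is therefore not needed.\<close>
lemma canonical_parameter_affine:
  assumes X: "valid_variable X" and Y: "valid_variable Y"
    and AE: "AE y in dominating Y. AE x in dominating X.
      x \<in> support_interior X \<and> y \<in> support_interior Y \<longrightarrow>
        f x * g y * exp (y * \<eta> x) = f' x * g' y * exp (x * \<zeta> y)"
    and pos: "\<And>x. x \<in> support_interior X \<Longrightarrow> 0 < f x \<and> 0 < f' x"
      "\<And>y. y \<in> support_interior Y \<Longrightarrow> 0 < g y \<and> 0 < g' y"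
    and C2: "C2_if_continuous X \<eta>"
  shows "affine_on (support_interior X) \<eta>"
proof -
  obtain y y' where y: "y \<in> support_interior Y" "y' \<in> support_interior Y" "y < y'"
    and AEy: "AE x in dominating X. x \<in> support_interior X \<and> y \<in> support_interior Y \<longrightarrow>
        f x * g y * exp (y * \<eta> x) = f' x * g' y * exp (x * \<zeta> y)"
      "AE x in dominating X. x \<in> support_interior X \<and> y' \<in> support_interior Y \<longrightarrow>
        f x * g y' * exp (y' * \<eta> x) = f' x * g' y' * exp (x * \<zeta> y')"
    using AE_dominating_two_points[OF Y AE] .
  \<comment> \<open>The intercept found by solving the difference of the two logarithmic equations
    for \<open>\<eta> x\<close>.\<close>
  define a where "a = (ln (g' y') - ln (g y') - (ln (g' y) - ln (g y))) / (y' - y)"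
  have log: "ln (f x) + ln (g y) + y * \<eta> x = ln (f' x) + ln (g' y) + x * \<zeta> y"
    if "f x * g y * exp (y * \<eta> x) = f' x * g' y * exp (x * \<zeta> y)"
      "x \<in> support_interior X" "y \<in> support_interior Y" for x y
    using arg_cong[OF that(1), of ln] pos(1)[OF that(2)] pos(2)[OF that(3)]
    by (simp add: ln_mult)
  have AE_affine: "AE x in dominating X. \<eta> x = a + (\<zeta> y' - \<zeta> y) / (y' - y) * x"
    using AEy AE_support_interior[OF X]
  proof eventually_elim
    case (elim x)
    then have "ln (f x) + ln (g y) + y * \<eta> x = ln (f' x) + ln (g' y) + x * \<zeta> y"
      "ln (f x) + ln (g y') + y' * \<eta> x = ln (f' x) + ln (g' y') + x * \<zeta> y'"
      using log y by auto
    then have "(y' - y) * \<eta> x = (ln (g' y') - ln (g y') - (ln (g' y) - ln (g y))) + (\<zeta> y' - \<zeta> y) * x"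
      by (simp add: algebra_simps)
    then have "\<eta> x = ((ln (g' y') - ln (g y') - (ln (g' y) - ln (g y))) + (\<zeta> y' - \<zeta> y) * x) / (y' - y)"
      using y by (simp add: field_simps)
    then show ?case by (simp add: a_def add_divide_distrib)
  qed
  \<comment> \<open>Continuity, or atoms in the count case, removes the exceptional null
    set.\<close>
  have "\<eta> x = a + (\<zeta> y' - \<zeta> y) / (y' - y) * x" if "x \<in> support_interior X" for x
  proof (rule AE_eq_imp_eq[OF X AE_affine _ that])
    fix S assume "X = Continuous S"
    then show "continuous_on (interior S) \<eta> \<and>
        continuous_on (interior S) (\<lambda>x. a + (\<zeta> y' - \<zeta> y) / (y' - y) * x)"
      using C2 by (intro conjI C2_on_imp_continuous_on continuous_on_add continuous_on_mult_left
        continuous_on_const continuous_on_id) simp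
  qed
  then show ?thesis unfolding affine_on_def by blast
qed

text \<open>Groups the log-partition factor with the source density, leaving a function of
  \<open>u\<close>, a function of \<open>w\<close> and an exponential cross term, as compared in
  \<open>canonical_parameter_affine\<close>.\<close>

lemma admissible_edge_factorization:
  assumes "admissible_edge U W q pU b \<eta>" "u \<in> support_interior U" "w \<in> support_interior W"
  shows "q u w = (pU u * exp (- log_partition W b (\<eta> u))) * b w * exp (w * \<eta> u)"
  using assms by (simp add: admissible_edge_def glm_factorization_def exp_diff exp_minus divide_inverse)

lemma admissible_edge_pos:
  assumes "admissible_edge U W q pU b \<eta>"
  shows "u \<in> support_interior U \<Longrightarrow> 0 < pU u" and "w \<in> support_interior W \<Longrightarrow> 0 < b w"
  using assms by (simp_all add: admissible_edge_def regular_glm_def regular_density_def)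

section \<open>Reversing an edge with affine canonical parameter\<close>

locale affine_edge =
  fixes X Y :: variable and P :: "(real \<times> real) measure" and p :: "real \<times> real \<Rightarrow> real"
    and pX bY \<eta> :: "real \<Rightarrow> real" and \<beta>\<^sub>0 \<beta>\<^sub>1 :: real
  assumes X: "valid_variable X" and Y: "valid_variable Y" and P: "prob_space P"
    and p: "joint_density X Y P p"
    and edge: "admissible_edge X Y (\<lambda>x y. p (x, y)) pX bY \<eta>"
    and affine: "\<And>x. x \<in> support_interior X \<Longrightarrow> \<eta> x = \<beta>\<^sub>0 + \<beta>\<^sub>1 * x"
begin

definition bX :: "real \<Rightarrow> real" where
  "bX = tilted_base Y pX bY \<beta>\<^sub>0 \<beta>\<^sub>1"

text \<open>The last factor is the partition integral of the reversed model, which makes this the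
  true marginal of \<open>Y\<close> and cancels against the normalisation in the reversed
  factorization.\<close>

definition pY :: "real \<Rightarrow> real" where
  "pY y = bY y * exp (\<beta>\<^sub>0 * y) * exp (log_partition X bX (\<beta>\<^sub>1 * y))"

lemma slope_nonzero: "\<beta>\<^sub>1 \<noteq> 0"
proof
  assume "\<beta>\<^sub>1 = 0"
  then have "\<eta> constant_on support_interior X"
    using affine by (auto simp: constant_on_def)
  then show False using edge by (auto simp: admissible_edge_def glm_factorization_def)
qed

lemma regular_pX: "regular_density X pX" and regular_bY: "regular_density Y bY"
  and natural: "\<And>x. x \<in> support_interior X \<Longrightarrow> \<beta>\<^sub>0 + \<beta>\<^sub>1 * x \<in> interior (natural_parameters Y bY)"
  using edge affine unfolding admissible_edge_def regular_glm_def by (auto simp: image_subset_iff)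

lemma joint:
  assumes "x \<in> support_interior X" "y \<in> support_interior Y"
  shows "p (x, y) = bX x * (bY y * exp (\<beta>\<^sub>0 * y)) * exp (x * (\<beta>\<^sub>1 * y))"
  using admissible_edge_factorization[OF edge assms] affine[OF assms(1)]
  by (simp add: bX_def tilted_base_def distrib_left exp_add mult_ac)

lemma regular_bX: "regular_density X bX"
  unfolding regular_density_def
proof (intro conjI ballI)
  show "0 < bX x" if "x \<in> support_interior X" for x
    using regular_pX that by (simp add: bX_def tilted_base_def regular_density_def)
  show "C2_if_continuous X (\<lambda>x. ln (bX x))"
  proof (cases X)
    case (Continuous S)
    \<comment> \<open>The log-partition function is smooth at
      \<open>\<beta>\<^sub>0 + \<beta>\<^sub>1 * x\<close> because \<open>natural\<close> puts these
      values in the interior of the natural parameters.\<close>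
    have "C2_on (interior S) (\<lambda>x. ln (pX x) + (- 1) * log_partition Y bY (\<beta>\<^sub>0 + \<beta>\<^sub>1 * x))"
      using regular_pX natural Continuous C2_on_log_partition[OF Y regular_bY]
      by (intro C2_on_add C2_on_cmult C2_on_affine_compose) (auto simp: regular_density_def)
    then have "C2_on (interior S) (\<lambda>x. ln (bX x))"
      by (rule C2_on_cong[rotated])
        (use regular_pX Continuous in \<open>auto simp: bX_def tilted_base_def regular_density_def ln_mult\<close>)
    then show ?thesis by (simp add: Continuous)
  qed simp
qed

lemma integral_joint:
  assumes "y \<in> support_interior Y"
  shows "(\<integral>\<^sup>+ x. ennreal (p (x, y)) \<partial>dominating X) =
    ennreal (bY y * exp (\<beta>\<^sub>0 * y)) * partition_integral X bX (\<beta>\<^sub>1 * y)"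
proof -
  note [measurable] = cutoff_measurable[OF regular_bX]
  have pos: "0 < bY y" using regular_bY assms by (simp add: regular_density_def)
  have "(\<integral>\<^sup>+ x. ennreal (p (x, y)) \<partial>dominating X) =
      (\<integral>\<^sup>+ x. ennreal (bY y * exp (\<beta>\<^sub>0 * y)) * ennreal (cutoff X bX x * exp (x * (\<beta>\<^sub>1 * y))) \<partial>dominating X)"
    by (rule nn_integral_cong_AE, use AE_support_interior[OF X] in eventually_elim)
      (use pos in \<open>simp add: joint assms mult_ac flip: ennreal_mult'\<close>)
  also have "\<dots> = ennreal (bY y * exp (\<beta>\<^sub>0 * y)) * partition_integral X bX (\<beta>\<^sub>1 * y)"
    unfolding partition_integral_cutoff[OF X] by (rule nn_integral_cmult) measurable
  finally show ?thesis .
qed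

lemma natural_reverse:
  assumes y: "y \<in> support_interior Y"
  shows "\<beta>\<^sub>1 * y \<in> interior (natural_parameters X bX)"
proof -
  \<comment> \<open>Since \<open>bY y\<close> is positive, finiteness of the integral of the joint
    density passes to the partition integral.\<close>
  have "AE y in dominating Y. \<beta>\<^sub>1 * y \<in> natural_parameters X bX"
    using AE_support_interior[OF Y] joint_density_nn_integral[OF X Y P p]
  proof eventually_elim
    case (elim y)
    then have "0 < bY y" using regular_bY by (simp add: regular_density_def)
    with elim show ?case
      by (auto simp: integral_joint natural_parameters_def ennreal_mult_eq_top_iff top.not_eq_extremum ennreal_eq_0_iff not_le)
  qed
  from AE_support_interior_between[OF Y this y] show ?thesis
  proof (elim disjE exE conjE)
    fix r s assume "r < y" "y < s" "\<beta>\<^sub>1 * r \<in> natural_parameters X bX" "\<beta>\<^sub>1 * s \<in> natural_parameters X bX"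
    \<comment> \<open>A negative slope reverses the order of the two bracketing points.\<close>
    then show ?thesis
      using natural_parameters_interior[OF X regular_bX, of "\<beta>\<^sub>1 * r" "\<beta>\<^sub>1 * s" "\<beta>\<^sub>1 * y"]
        natural_parameters_interior[OF X regular_bX, of "\<beta>\<^sub>1 * s" "\<beta>\<^sub>1 * r" "\<beta>\<^sub>1 * y"] slope_nonzero
      by (cases "\<beta>\<^sub>1 > 0") (auto simp: mult_less_cancel_left)
  next
    \<comment> \<open>At an endpoint bracketing may fail, and the affine reversibility condition of
      the given edge is exactly the claim.\<close>
    fix K assume K: "Y = Count K" "y \<in> support_endpoints K"
    then have "\<beta>\<^sub>1 * y \<in> interior (natural_parameters X (tilted_base Y pX bY \<beta>\<^sub>0 \<beta>\<^sub>1))"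
      using edge[unfolded admissible_edge_def affine_reversible_def, THEN conjunct2, THEN conjunct2,
          rule_format, of \<beta>\<^sub>1 \<beta>\<^sub>0] slope_nonzero affine
      by simp
    then show ?thesis by (simp only: bX_def)
  qed
qed

lemma regular_pY: "regular_density Y pY"
  unfolding regular_density_def
proof (intro conjI ballI)
  show "0 < pY y" if "y \<in> support_interior Y" for y
    using regular_bY that by (simp add: pY_def regular_density_def)
  show "C2_if_continuous Y (\<lambda>y. ln (pY y))"
  proof (cases Y)
    case (Continuous S)
    have pos: "\<And>y. y \<in> interior S \<Longrightarrow> 0 < bY y"
      using regular_bY Continuous by (simp add: regular_density_def)
    \<comment> \<open>The summand 0 brings the argument into the form that
      \<open>C2_on_affine_compose\<close> expects.\<close>
    have "C2_on (interior S) (\<lambda>y. ln (bY y) + \<beta>\<^sub>0 * y + log_partition X bX (0 + \<beta>\<^sub>1 * y))"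
      using regular_bY natural_reverse Continuous C2_on_log_partition[OF X regular_bX]
      by (intro C2_on_add C2_on_cmult C2_on_ident C2_on_affine_compose) (auto simp: regular_density_def)
    then have "C2_on (interior S) (\<lambda>y. ln (pY y))"
      by (rule C2_on_cong[rotated])
        (use pos in \<open>auto simp: pY_def ln_mult less_imp_neq[symmetric]\<close>)
    then show ?thesis by (simp add: Continuous)
  qed simp
qed

lemma admissible_reverse:
  "admissible_edge Y X (\<lambda>y x. p (x, y)) pY bX (\<lambda>y. \<beta>\<^sub>1 * y)"
  unfolding admissible_edge_def
proof (intro conjI)
  obtain y y' where y: "y \<in> support_interior Y" "y' \<in> support_interior Y" "y < y'"
    by (rule support_interior_two_points[OF Y])
  have "\<not> (\<lambda>y. \<beta>\<^sub>1 * y) constant_on support_interior Y"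
    using y slope_nonzero unfolding constant_on_def by (metis less_irrefl mult_left_cancel)
  moreover have "marginal_density Y X (\<lambda>y x. p (x, y)) pY"
    unfolding marginal_density_def
  proof
    fix y assume y: "y \<in> support_interior Y"
    then have "0 < bY y" using regular_bY by (simp add: regular_density_def)
    moreover have "\<beta>\<^sub>1 * y \<in> natural_parameters X bX"
      using natural_reverse[OF y] interior_subset by blast
    ultimately show "ennreal (pY y) = (\<integral>\<^sup>+ x. ennreal (p (x, y)) \<partial>dominating X)"
      using exp_log_partition[OF X regular_bX, symmetric]
      by (simp add: integral_joint[OF y] pY_def ennreal_mult')
  qed
  ultimately show "glm_factorization Y X (\<lambda>y x. p (x, y)) pY bX (\<lambda>y. \<beta>\<^sub>1 * y)"
    by (simp add: glm_factorization_def joint pY_def exp_diff)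
  show "regular_glm Y X pY bX (\<lambda>y. \<beta>\<^sub>1 * y)"
    using regular_pY regular_bX natural_reverse C2_on_cmult[OF C2_on_ident]
    by (cases Y) (auto simp: regular_glm_def)
  \<comment> \<open>The reversed parameter function is affine too, so its own reversibility
    condition has to be met; it follows from the regularity of the original edge.\<close>
  show "affine_reversible Y X pY bX (\<lambda>y. \<beta>\<^sub>1 * y)"
    unfolding affine_reversible_def
  proof (intro allI impI)
    fix \<gamma>\<^sub>0 \<gamma>\<^sub>1 assume *: "\<gamma>\<^sub>1 \<noteq> 0 \<and> (\<forall>y\<in>support_interior Y. \<beta>\<^sub>1 * y = \<gamma>\<^sub>0 + \<gamma>\<^sub>1 * y)"
    \<comment> \<open>Two distinct support points determine the affine coefficients.\<close>
    have "(\<beta>\<^sub>1 - \<gamma>\<^sub>1) * (y' - y) = 0"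
      using *[THEN conjunct2, rule_format, OF y(1)] *[THEN conjunct2, rule_format, OF y(2)]
      by (simp add: algebra_simps)
    then have \<gamma>\<^sub>1: "\<gamma>\<^sub>1 = \<beta>\<^sub>1" using y by simp
    then have \<gamma>\<^sub>0: "\<gamma>\<^sub>0 = 0" using * y by auto
    \<comment> \<open>Tilting undoes the normalisation in \<open>pY\<close> and leaves
      \<open>bY y * exp (\<beta>\<^sub>0 * y)\<close>, so the natural parameters of
      \<open>bY\<close> are merely translated.\<close>
    have "partition_integral Y (tilted_base X pY bX 0 \<beta>\<^sub>1) t = partition_integral Y bY (\<beta>\<^sub>0 + t)" for t
      by (simp add: tilted_base_def[abs_def] pY_def mult.assoc partition_integral_tilt flip: exp_add)
    then have "natural_parameters Y (tilted_base X pY bX 0 \<beta>\<^sub>1) = (+) (- \<beta>\<^sub>0) ` natural_parameters Y bY"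
      by (auto simp: natural_parameters_def image_iff algebra_simps intro!: exI[of _ "\<beta>\<^sub>0 + _"])
    then have "interior (natural_parameters Y (tilted_base X pY bX 0 \<beta>\<^sub>1)) =
        (+) (- \<beta>\<^sub>0) ` interior (natural_parameters Y bY)"
      by (simp only: interior_translation)
    moreover have "\<beta>\<^sub>1 * e \<in> (+) (- \<beta>\<^sub>0) ` interior (natural_parameters Y bY)"
      if "e \<in> support_interior X" for e
      using natural[OF that] by (intro image_eqI[of _ _ "\<beta>\<^sub>0 + \<beta>\<^sub>1 * e"]) auto
    ultimately have reverse: "\<forall>e\<in>support_interior X.
        \<beta>\<^sub>1 * e \<in> interior (natural_parameters Y (tilted_base X pY bX 0 \<beta>\<^sub>1))"
      by simp
    show "case X of Continuous S \<Rightarrow> True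
        | Count K \<Rightarrow> \<forall>e\<in>support_endpoints K.
            \<gamma>\<^sub>1 * e \<in> interior (natural_parameters Y (tilted_base X pY bX \<gamma>\<^sub>0 \<gamma>\<^sub>1))"
      unfolding \<gamma>\<^sub>0 \<gamma>\<^sub>1
    proof (cases X)
      case (Count K)
      have "support_endpoints K \<subseteq> support_interior X"
        unfolding Count by (auto simp: support_endpoints_def)
      with reverse have "\<forall>e\<in>support_endpoints K.
          \<beta>\<^sub>1 * e \<in> interior (natural_parameters Y (tilted_base X pY bX 0 \<beta>\<^sub>1))"
        by blast
      with Count show "case X of Continuous S \<Rightarrow> True
          | Count K \<Rightarrow> \<forall>e\<in>support_endpoints K.
              \<beta>\<^sub>1 * e \<in> interior (natural_parameters Y (tilted_base X pY bX 0 \<beta>\<^sub>1))"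
        by simp
    qed simp
  qed
qed

end

theorem theorem6:
  fixes X Y :: variable
    and P :: "(real \<times> real) measure"
    and pX bY \<eta> :: "real \<Rightarrow> real"
  assumes "valid_variable X" and "valid_variable Y"
    and "prob_space P"
    and "Rep_XY pX bY \<eta> \<in> model_class X Y P"
  shows "identifiable_X_to_Y X Y P \<longleftrightarrow> \<not> affine_on (support_interior X) \<eta>"
proof -
  obtain p where p: "joint_density X Y P p"
    and edge: "admissible_edge X Y (\<lambda>x y. p (x, y)) pX bY \<eta>"
    using assms(4) by (auto simp: model_class_def)
  have fact: "p (x, y) = (pX x * exp (- log_partition Y bY (\<eta> x))) * bY y * exp (y * \<eta> x)"
    if "x \<in> support_interior X" "y \<in> support_interior Y" for x y
    by (rule admissible_edge_factorization[OF edge that])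
  note pos = admissible_edge_pos[OF edge]
  have C2: "C2_if_continuous X \<eta>"
    using edge by (simp add: admissible_edge_def regular_glm_def)
  show ?thesis
  proof
    assume id: "identifiable_X_to_Y X Y P"
    show "\<not> affine_on (support_interior X) \<eta>"
    proof
      assume "affine_on (support_interior X) \<eta>"
      then obtain \<beta>\<^sub>0 \<beta>\<^sub>1 where \<eta>: "\<And>x. x \<in> support_interior X \<Longrightarrow> \<eta> x = \<beta>\<^sub>0 + \<beta>\<^sub>1 * x"
        by (auto simp: affine_on_def)
      interpret affine_edge X Y P p pX bY \<eta> \<beta>\<^sub>0 \<beta>\<^sub>1
        by (rule affine_edge.intro[OF assms(1-3) p edge \<eta>])
      \<comment> \<open>The reversed edge factorizes the same version \<open>p\<close> of the
        density.\<close>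
      have "Rep_YX pY bX (\<lambda>y. \<beta>\<^sub>1 * y) \<in> model_class X Y P"
        using p admissible_reverse by (auto simp: model_class_def)
      with id show False by (force simp: identifiable_X_to_Y_def)
    qed
  next
    assume nonaffine: "\<not> affine_on (support_interior X) \<eta>"
    show "identifiable_X_to_Y X Y P"
      unfolding identifiable_X_to_Y_def
    proof
      fix R assume "R \<in> model_class X Y P"
      then obtain p' where p': "joint_density X Y P p'" "admissible X Y p' R"
        by (auto simp: model_class_def)
      note AE = joint_density_AE_eq[OF assms(1,2) p p'(1)]
      \<comment> \<open>Both competing graphs give a density of this form, the empty one with
        \<open>\<zeta> = 0\<close>, so one contradiction serves both.\<close>
      have affine: False
        if eq: "\<And>x y. x \<in> support_interior X \<Longrightarrow> y \<in> support_interior Y \<Longrightarrow>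
            p' (x, y) = f x * g y * exp (x * \<zeta> y)"
          and fg: "\<And>x. x \<in> support_interior X \<Longrightarrow> 0 < f x" "\<And>y. y \<in> support_interior Y \<Longrightarrow> 0 < g y"
        for f g \<zeta>
      proof -
        have "AE y in dominating Y. AE x in dominating X.
          x \<in> support_interior X \<and> y \<in> support_interior Y \<longrightarrow>
            (pX x * exp (- log_partition Y bY (\<eta> x))) * bY y * exp (y * \<eta> x) = f x * g y * exp (x * \<zeta> y)"
          using AE by (elim eventually_mono) (metis fact eq)
        then have "affine_on (support_interior X) \<eta>"
          by (rule canonical_parameter_affine[OF assms(1,2)]) (use pos fg C2 in auto)
        with nonaffine show False ..
      qed
      show "graph_of R = X_to_Y"
      proof (cases R)
        case (Rep_YX pY' bX' \<zeta>)
        then have edge': "admissible_edge Y X (\<lambda>y x. p' (x, y)) pY' bX' \<zeta>" using p' by simp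
        \<comment> \<open>Here the log-partition term depends on \<open>y\<close> and therefore
          belongs to \<open>g\<close>.\<close>
        have False
          by (rule affine[of bX' "\<lambda>y. pY' y * exp (- log_partition X bX' (\<zeta> y))" \<zeta>])
            (use admissible_edge_factorization[OF edge'] admissible_edge_pos[OF edge'] in \<open>simp_all add: mult_ac\<close>)
        then show ?thesis ..
      next
        case (Rep_Empty pX' pY')
        have False
          by (rule affine[of pX' pY' "\<lambda>_. 0"])
            (use p' Rep_Empty in \<open>auto simp: admissible_empty_def regular_density_def\<close>)
        then show ?thesis ..
      qed simp
    qed
  qed
qed

end
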